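(* (Subject reduction.) Let $\Gamma$ be a finite map from variables to types, $\Delta$ a finite map from continuation variables to arrow-free types, $t, t'$ terms and $\rho$ a type. If $\Gamma;\Delta \vdash t : \rho$ and $t \to t'$, then $\Gamma;\Delta \vdash t' : \rho$.
   Context: Calculus $\lambda^{::}_{\mathtt{catch}}$. Types: $\sigma,\tau,\rho ::= \mathtt{unit} \mid \mathtt{list}\,\tau \mid \sigma\to\tau$ ($\to$ associates to the right). A type is arrow-free if it contains no $\to$; $\psi$ ranges over arrow-free types. Terms: $t,r,s ::= x \mid () \mid \mathtt{nil} \mid (::) \mid \mathtt{lrec} \mid \lambda x.r \mid t\,s \mid \mathtt{catch}\,\alpha\,t \mid \mathtt{throw}\,\alpha\,t$, where $x$ ranges over variables and $\alpha,\beta$ over continuation variables; $\lambda x$ binds $x$ and $\mathtt{catch}\,\alpha$ binds $\alpha$ (terms modulo renaming of bound variables); application associates to the left; $t :: r$ abbreviates $(::)\,t\,r$. $\mathrm{FCV}(t)$ is the set of free continuation variables; $t[x:=r]$ is capture-avoiding substitution. Values: $v,w ::= x \mid () \mid \mathtt{nil} \mid (::) \mid (::)\,v \mid (::)\,v\,w \mid \mathtt{lrec} \mid \mathtt{lrec}\,v \mid \mathtt{lrec}\,v\,w \mid \lambda x.r$. Contexts $E ::= \Box\,t \mid v\,\Box \mid \mathtt{throw}\,\alpha\,\Box$. Reduction $\to$ is the compatible closure (closure under all term constructors) of: $(\lambda x.t)\,v \to t[x:=v]$; $E[\mathtt{throw}\,\alpha\,t] \to \mathtt{throw}\,\alpha\,t$;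 $\mathtt{catch}\,\alpha\,(\mathtt{throw}\,\alpha\,t) \to \mathtt{catch}\,\alpha\,t$; $\mathtt{catch}\,\alpha\,(\mathtt{throw}\,\beta\,v) \to \mathtt{throw}\,\beta\,v$ if $\alpha\notin\{\beta\}\cup\mathrm{FCV}(v)$; $\mathtt{catch}\,\alpha\,v \to v$ if $\alpha\notin\mathrm{FCV}(v)$; $\mathtt{lrec}\,v_r\,v_s\,\mathtt{nil} \to v_r$; $\mathtt{lrec}\,v_r\,v_s\,(v_h :: v_t) \to v_s\,v_h\,v_t\,(\mathtt{lrec}\,v_r\,v_s\,v_t)$. Typing $\Gamma;\Delta\vdash t:\rho$ ($\Gamma$ maps variables to types, $\Delta$ maps continuation variables to arrow-free types) is given by: $x:\rho$ if $x:\rho\in\Gamma$; $():\mathtt{unit}$; $\mathtt{nil}:\mathtt{list}\,\sigma$; $(::):\sigma\to\mathtt{list}\,\sigma\to\mathtt{list}\,\sigma$; $\mathtt{lrec}:\rho\to(\sigma\to\mathtt{list}\,\sigma\to\rho\to\rho)\to\mathtt{list}\,\sigma\to\rho$ (any $\sigma,\rho$); if $\Gamma,x:\sigma;\Delta\vdash t:\tau$ then $\Gamma;\Delta\vdash\lambda x.t:\sigma\to\tau$; if $\Gamma;\Delta\vdash t:\sigma\to\tau$ and $\Gamma;\Delta\vdash s:\sigma$ then $\Gamma;\Delta\vdash ts:\tau$; if $\Gamma;\Delta,\alpha:\psi\vdash t:\psi$ with $\psi$ arrow-free then $\Gamma;\Delta\vdash\mathtt{catch}\,\alpha\,t:\psi$;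 if $\Gamma;\Delta\vdash t:\psi$ and $\alpha:\psi\in\Delta$ then $\Gamma;\Delta\vdash\mathtt{throw}\,\alpha\,t:\tau$ for any type $\tau$. *)

theory Defs
  imports Main
begin

text \<open>
  Terms modulo renaming of bound variables are represented by de Bruijn indices, with two
  independent index spaces: \<open>Lam\<close> binds index 0 of the variables, \<open>Catch\<close> binds index 0 of the
  continuation variables.  A free index \<open>n\<close> below \<open>d\<close> binders of its kind is written \<open>n + d\<close>.
\<close>

datatype ty = TUnit | TList ty | TArrow ty ty  (infixr \<open>\<rightarrow>\<^sub>t\<close> 65)

fun arrow_free :: "ty \<Rightarrow> bool" where
  "arrow_free TUnit = True"
| "arrow_free (TList \<tau>) = arrow_free \<tau>"
| "arrow_free (\<sigma> \<rightarrow>\<^sub>t \<tau>) = False"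

datatype tm =
    Var nat
  | Triv
  | NilC
  | ConsC
  | Lrec
  | Lam tm
  | App tm tm  (infixl \<open>\<cdot>\<close> 75)
  | Catch tm
  | Throw nat tm

inductive is_value :: "tm \<Rightarrow> bool" where
  "is_value (Var x)"
| "is_value Triv"
| "is_value NilC"
| "is_value ConsC"
| "is_value v \<Longrightarrow> is_value (ConsC \<cdot> v)"
| "is_value v \<Longrightarrow> is_value w \<Longrightarrow> is_value (ConsC \<cdot> v \<cdot> w)"
| "is_value Lrec"
| "is_value v \<Longrightarrow> is_value (Lrec \<cdot> v)"
| "is_value v \<Longrightarrow> is_value w \<Longrightarrow> is_value (Lrec \<cdot> v \<cdot> w)"
| "is_value (Lam r)"

primrec FCV :: "tm \<Rightarrow> nat set" where
  "FCV (Var x) = {}"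
| "FCV Triv = {}"
| "FCV NilC = {}"
| "FCV ConsC = {}"
| "FCV Lrec = {}"
| "FCV (Lam r) = FCV r"
| "FCV (t \<cdot> s) = FCV t \<union> FCV s"
| "FCV (Catch t) = {\<alpha>. Suc \<alpha> \<in> FCV t}"
| "FCV (Throw \<alpha> t) = insert \<alpha> (FCV t)"

definition lift_ren :: "(nat \<Rightarrow> nat) \<Rightarrow> nat \<Rightarrow> nat" where
  "lift_ren f = case_nat 0 (\<lambda>n. Suc (f n))"

primrec vren :: "(nat \<Rightarrow> nat) \<Rightarrow> tm \<Rightarrow> tm" where
  "vren f (Var x) = Var (f x)"
| "vren f Triv = Triv"
| "vren f NilC = NilC"
| "vren f ConsC = ConsC"
| "vren f Lrec = Lrec"
| "vren f (Lam r) = Lam (vren (lift_ren f) r)"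
| "vren f (t \<cdot> s) = vren f t \<cdot> vren f s"
| "vren f (Catch t) = Catch (vren f t)"
| "vren f (Throw \<alpha> t) = Throw \<alpha> (vren f t)"

primrec cren :: "(nat \<Rightarrow> nat) \<Rightarrow> tm \<Rightarrow> tm" where
  "cren f (Var x) = Var x"
| "cren f Triv = Triv"
| "cren f NilC = NilC"
| "cren f ConsC = ConsC"
| "cren f Lrec = Lrec"
| "cren f (Lam r) = Lam (cren f r)"
| "cren f (t \<cdot> s) = cren f t \<cdot> cren f s"
| "cren f (Catch t) = Catch (cren (lift_ren f) t)"
| "cren f (Throw \<alpha> t) = Throw (f \<alpha>) (cren f t)"

text \<open>
  Simultaneous substitution.  Substituted terms are shifted in both index spaces, so neither
  variables nor continuation variables are captured.
\<close>

primrec subst :: "(nat \<Rightarrow> tm) \<Rightarrow> tm \<Rightarrow> tm" where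
  "subst \<theta> (Var x) = \<theta> x"
| "subst \<theta> Triv = Triv"
| "subst \<theta> NilC = NilC"
| "subst \<theta> ConsC = ConsC"
| "subst \<theta> Lrec = Lrec"
| "subst \<theta> (Lam r) = Lam (subst (case_nat (Var 0) (\<lambda>n. vren Suc (\<theta> n))) r)"
| "subst \<theta> (t \<cdot> s) = subst \<theta> t \<cdot> subst \<theta> s"
| "subst \<theta> (Catch t) = Catch (subst (\<lambda>n. cren Suc (\<theta> n)) t)"
| "subst \<theta> (Throw \<alpha> t) = Throw \<alpha> (subst \<theta> t)"

text \<open>
  \<open>subst0 t r\<close> is the $t[x:=r]$ of a contracted $(\lambda x.t)\,r$: index 0 is replaced by \<open>r\<close> and
  the remaining indices drop by one, as their enclosing \<open>Lam\<close> disappears.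
\<close>

definition subst0 :: "tm \<Rightarrow> tm \<Rightarrow> tm" where
  "subst0 t r = subst (case_nat r Var) t"

text \<open>
  \<open>drop_catch v\<close> is the same term as \<open>v\<close>, moved out of the scope of a \<open>Catch\<close>; meaningful
  only if \<open>0 \<notin> FCV v\<close>.
\<close>

definition drop_catch :: "tm \<Rightarrow> tm" where
  "drop_catch v = cren (\<lambda>\<alpha>. \<alpha> - 1) v"

text \<open>
  $E ::= \Box\,t \mid v\,\Box \mid \mathtt{throw}\,\alpha\,\Box$, where
  \<open>is_ectx\<close> requires $v$ to be a value.
\<close>

datatype ectx = AppL tm | AppR tm | ThrowC nat

inductive is_ectx :: "ectx \<Rightarrow> bool" where
  "is_ectx (AppL t)"
| "is_value v \<Longrightarrow> is_ectx (AppR v)"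
| "is_ectx (ThrowC \<alpha>)"

primrec fill :: "ectx \<Rightarrow> tm \<Rightarrow> tm" where
  "fill (AppL t) s = s \<cdot> t"
| "fill (AppR v) s = v \<cdot> s"
| "fill (ThrowC \<alpha>) s = Throw \<alpha> s"

inductive contract :: "tm \<Rightarrow> tm \<Rightarrow> bool" where
  beta: "is_value v \<Longrightarrow> contract (Lam t \<cdot> v) (subst0 t v)"
| throw: "is_ectx E \<Longrightarrow> contract (fill E (Throw \<alpha> t)) (Throw \<alpha> t)"
| catch_throw_same: "contract (Catch (Throw 0 t)) (Catch t)"
| catch_throw_other: "is_value v \<Longrightarrow> 0 \<notin> {\<beta>} \<union> FCV v \<Longrightarrow>
    contract (Catch (Throw \<beta> v)) (drop_catch (Throw \<beta> v))"
| catch_value: "is_value v \<Longrightarrow> 0 \<notin> FCV v \<Longrightarrow> contract (Catch v) (drop_catch v)"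
| lrec_nil: "is_value v\<^sub>r \<Longrightarrow> is_value v\<^sub>s \<Longrightarrow> contract (Lrec \<cdot> v\<^sub>r \<cdot> v\<^sub>s \<cdot> NilC) v\<^sub>r"
| lrec_cons: "is_value v\<^sub>r \<Longrightarrow> is_value v\<^sub>s \<Longrightarrow> is_value v\<^sub>h \<Longrightarrow> is_value v\<^sub>t \<Longrightarrow>
    contract (Lrec \<cdot> v\<^sub>r \<cdot> v\<^sub>s \<cdot> (ConsC \<cdot> v\<^sub>h \<cdot> v\<^sub>t))
      (v\<^sub>s \<cdot> v\<^sub>h \<cdot> v\<^sub>t \<cdot> (Lrec \<cdot> v\<^sub>r \<cdot> v\<^sub>s \<cdot> v\<^sub>t))"

inductive red :: "tm \<Rightarrow> tm \<Rightarrow> bool"  (infix \<open>\<leadsto>\<close> 50) where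
  contract: "contract t t' \<Longrightarrow> t \<leadsto> t'"
| Lam: "t \<leadsto> t' \<Longrightarrow> Lam t \<leadsto> Lam t'"
| AppL: "t \<leadsto> t' \<Longrightarrow> t \<cdot> s \<leadsto> t' \<cdot> s"
| AppR: "s \<leadsto> s' \<Longrightarrow> t \<cdot> s \<leadsto> t \<cdot> s'"
| Catch: "t \<leadsto> t' \<Longrightarrow> Catch t \<leadsto> Catch t'"
| Throw: "t \<leadsto> t' \<Longrightarrow> Throw \<alpha> t \<leadsto> Throw \<alpha> t'"

text \<open>
  \<open>extend \<sigma> \<Gamma>\<close> is $\Gamma, x:\sigma$ for the variable $x$ of a binder being entered, which is index 0.
\<close>

definition extend :: "ty \<Rightarrow> (nat \<rightharpoonup> ty) \<Rightarrow> (nat \<rightharpoonup> ty)" where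
  "extend \<sigma> \<Gamma> = case_nat (Some \<sigma>) \<Gamma>"

inductive has_type :: "(nat \<rightharpoonup> ty) \<Rightarrow> (nat \<rightharpoonup> ty) \<Rightarrow> tm \<Rightarrow> ty \<Rightarrow> bool" where
  Var: "\<Gamma> x = Some \<rho> \<Longrightarrow> has_type \<Gamma> \<Delta> (Var x) \<rho>"
| Triv: "has_type \<Gamma> \<Delta> Triv TUnit"
| NilC: "has_type \<Gamma> \<Delta> NilC (TList \<sigma>)"
| ConsC: "has_type \<Gamma> \<Delta> ConsC (\<sigma> \<rightarrow>\<^sub>t TList \<sigma> \<rightarrow>\<^sub>t TList \<sigma>)"
| Lrec: "has_type \<Gamma> \<Delta> Lrec
    (\<rho> \<rightarrow>\<^sub>t (\<sigma> \<rightarrow>\<^sub>t TList \<sigma> \<rightarrow>\<^sub>t \<rho> \<rightarrow>\<^sub>t \<rho>) \<rightarrow>\<^sub>t TList \<sigma> \<rightarrow>\<^sub>t \<rho>)"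
| Lam: "has_type (extend \<sigma> \<Gamma>) \<Delta> t \<tau> \<Longrightarrow> has_type \<Gamma> \<Delta> (Lam t) (\<sigma> \<rightarrow>\<^sub>t \<tau>)"
| App: "has_type \<Gamma> \<Delta> t (\<sigma> \<rightarrow>\<^sub>t \<tau>) \<Longrightarrow> has_type \<Gamma> \<Delta> s \<sigma> \<Longrightarrow> has_type \<Gamma> \<Delta> (t \<cdot> s) \<tau>"
| Catch: "arrow_free \<psi> \<Longrightarrow> has_type \<Gamma> (extend \<psi> \<Delta>) t \<psi> \<Longrightarrow> has_type \<Gamma> \<Delta> (Catch t) \<psi>"
| Throw: "arrow_free \<psi> \<Longrightarrow> has_type \<Gamma> \<Delta> t \<psi> \<Longrightarrow> \<Delta> \<alpha> = Some \<psi> \<Longrightarrow>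
    has_type \<Gamma> \<Delta> (Throw \<alpha> t) \<tau>"

end

theory Submission
  imports Defs
begin

text \<open>Typing is syntax-directed, so inverting the typing of a redex yields types for its
  parts, from which the contractum is retyped; compatible closure follows by induction. Three
  ingredients carry the contractions. Beta rests on the substitution lemma
  \<open>has_type_subst\<close>, which needs weakening in both index spaces because substituted
  terms pass under both binders. Leaving a \<open>Catch\<close> rests on strengthening: a
  continuation variable that does not occur can be removed from \<Delta>. Finally, a
  \<open>Throw\<close> may be given any type, so it can replace the whole term around it.\<close>

inductive_cases has_type_ThrowE: "has_type \<Gamma> \<Delta> (Throw \<alpha> t) \<rho>"
inductive_cases has_type_CatchE: "has_type \<Gamma> \<Delta> (Catch t) \<rho>"
inductive_cases has_type_AppE: "has_type \<Gamma> \<Delta> (t \<cdot> s) \<rho>"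
inductive_cases has_type_LamE: "has_type \<Gamma> \<Delta> (Lam t) \<rho>"
inductive_cases has_type_LrecE: "has_type \<Gamma> \<Delta> Lrec \<rho>"
inductive_cases has_type_ConsCE: "has_type \<Gamma> \<Delta> ConsC \<rho>"

lemma extend_simps [simp]:
  "extend \<sigma> \<Gamma> 0 = Some \<sigma>"
  "extend \<sigma> \<Gamma> (Suc n) = \<Gamma> n"
  by (simp_all add: extend_def)

lemma lift_ren_simps [simp]:
  "lift_ren f 0 = 0"
  "lift_ren f (Suc n) = Suc (f n)"
  by (simp_all add: lift_ren_def)

lemma has_type_vren:
  assumes "has_type \<Gamma> \<Delta> t \<rho>" and "\<And>x \<tau>. \<Gamma> x = Some \<tau> \<Longrightarrow> \<Gamma>' (f x) = Some \<tau>"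
  shows "has_type \<Gamma>' \<Delta> (vren f t) \<rho>"
  using assms
proof (induction arbitrary: \<Gamma>' f rule: has_type.induct)
  case (Lam \<sigma> \<Gamma> \<Delta> t \<tau>)
  have "extend \<sigma> \<Gamma>' (lift_ren f x) = Some \<tau>'" if "extend \<sigma> \<Gamma> x = Some \<tau>'" for x \<tau>'
    using that Lam.prems by (cases x) auto
  then show ?case
    by (auto intro: has_type.Lam Lam.IH)
next
  case (App \<Gamma> \<Delta> t \<sigma> \<tau> s)
  show ?case
    unfolding vren.simps by (rule has_type.App; rule App.IH) (auto intro: App.prems)
qed (auto intro: has_type.intros)

text \<open>The environments need to agree only on continuation variables that occur in
  \<open>t\<close>. Hence one lemma yields both weakening (\<open>f\<close> is \<open>Suc\<close>)
  and strengthening (\<open>f\<close> is the predecessor, when index 0 does not occur).\<close>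

lemma has_type_cren:
  assumes "has_type \<Gamma> \<Delta> t \<rho>" and "\<And>\<alpha>. \<alpha> \<in> FCV t \<Longrightarrow> \<Delta>' (f \<alpha>) = \<Delta> \<alpha>"
  shows "has_type \<Gamma> \<Delta>' (cren f t) \<rho>"
  using assms
proof (induction arbitrary: \<Delta>' f rule: has_type.induct)
  case (Catch \<psi> \<Gamma> \<Delta> t)
  \<comment> \<open>Index 0 is the bound variable, of type \<psi> on both sides; a successor in
    \<open>FCV t\<close> is a free variable of \<open>Catch t\<close>, covered by the
    assumption.\<close>
  have "extend \<psi> \<Delta>' (lift_ren f \<alpha>) = extend \<psi> \<Delta> \<alpha>" if "\<alpha> \<in> FCV t" for \<alpha>
    using that Catch.prems by (cases \<alpha>) auto
  then show ?case
    using Catch.hyps by (auto intro: has_type.Catch Catch.IH)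
next
  case (App \<Gamma> \<Delta> t \<sigma> \<tau> s)
  show ?case
    unfolding cren.simps by (rule has_type.App; rule App.IH) (auto intro: App.prems)
qed (auto intro: has_type.intros)

lemma has_type_subst:
  assumes "has_type \<Gamma> \<Delta> t \<rho>" and "\<And>x \<tau>. \<Gamma> x = Some \<tau> \<Longrightarrow> has_type \<Gamma>' \<Delta> (\<theta> x) \<tau>"
  shows "has_type \<Gamma>' \<Delta> (subst \<theta> t) \<rho>"
  using assms
proof (induction arbitrary: \<Gamma>' \<theta> rule: has_type.induct)
  case (Lam \<sigma> \<Gamma> \<Delta> t \<tau>)
  have "has_type (extend \<sigma> \<Gamma>') \<Delta> (case_nat (Var 0) (\<lambda>n. vren Suc (\<theta> n)) x) \<tau>'"
    if "extend \<sigma> \<Gamma> x = Some \<tau>'" for x \<tau>'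
  proof (cases x)
    case (Suc n)
    with that have "has_type \<Gamma>' \<Delta> (\<theta> n) \<tau>'"
      by (simp add: Lam.prems)
    then have "has_type (extend \<sigma> \<Gamma>') \<Delta> (vren Suc (\<theta> n)) \<tau>'"
      by (rule has_type_vren) simp
    with Suc show ?thesis by simp
  qed (use that in \<open>auto intro: has_type.Var\<close>)
  then show ?case
    by (auto intro: has_type.Lam Lam.IH)
next
  case (Catch \<psi> \<Gamma> \<Delta> t)
  \<comment> \<open>Under \<open>Catch\<close> the substituted terms are weakened by the new
    continuation variable.\<close>
  have "has_type \<Gamma>' (extend \<psi> \<Delta>) (cren Suc (\<theta> x)) \<tau>" if "\<Gamma> x = Some \<tau>" for x \<tau>
    using Catch.prems[OF that] by (rule has_type_cren) simp
  then show ?case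
    using Catch.hyps by (auto intro: has_type.Catch Catch.IH)
next
  case (App \<Gamma> \<Delta> t \<sigma> \<tau> s)
  show ?case
    unfolding subst.simps by (rule has_type.App; rule App.IH) (auto intro: App.prems)
qed (auto intro: has_type.intros)

lemma has_type_subst0:
  assumes "has_type (extend \<sigma> \<Gamma>) \<Delta> t \<tau>" and "has_type \<Gamma> \<Delta> v \<sigma>"
  shows "has_type \<Gamma> \<Delta> (subst0 t v) \<tau>"
  unfolding subst0_def using assms(1)
proof (rule has_type_subst)
  show "has_type \<Gamma> \<Delta> (case_nat v Var x) \<tau>'" if "extend \<sigma> \<Gamma> x = Some \<tau>'" for x \<tau>'
    using that assms(2) by (cases x) (auto intro: has_type.Var)
qed

lemma has_type_drop_catch:
  assumes "has_type \<Gamma> (extend \<psi> \<Delta>) t \<rho>" and "0 \<notin> FCV t"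
  shows "has_type \<Gamma> \<Delta> (drop_catch t) \<rho>"
  unfolding drop_catch_def using assms(1)
proof (rule has_type_cren)
  show "\<Delta> (\<alpha> - 1) = extend \<psi> \<Delta> \<alpha>" if "\<alpha> \<in> FCV t" for \<alpha>
    \<comment> \<open>Truncated subtraction sends 0 to 0, where the equation could fail, but 0 is
      excluded by the second assumption.\<close>
    using that assms(2) by (cases \<alpha>) auto
qed

lemma has_type_contract:
  assumes "contract t t'" and "has_type \<Gamma> \<Delta> t \<rho>"
  shows "has_type \<Gamma> \<Delta> t' \<rho>"
  using assms
proof (induction rule: contract.induct)
  case (beta v t)
  then show ?case
    by (auto elim!: has_type_AppE has_type_LamE intro: has_type_subst0)
next
  case (throw E \<alpha> t)
  \<comment> \<open>Here \<tau> is the type of the hole of \<open>E\<close>, in general different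
    from \<rho>; the \<open>Throw\<close> is then retyped at \<rho>.\<close>
  then obtain \<tau> where "has_type \<Gamma> \<Delta> (Throw \<alpha> t) \<tau>"
    by (cases E) (auto elim: has_type_AppE has_type_ThrowE)
  then show ?case
    by (auto elim: has_type_ThrowE intro: has_type.Throw)
next
  case (catch_throw_same t)
  then show ?case
    \<comment> \<open>Index 0 has the type of the \<open>Catch\<close> itself, so the thrown term
      has that type too.\<close>
    by (auto elim!: has_type_CatchE has_type_ThrowE intro: has_type.Catch)
next
  case (catch_throw_other v \<beta>)
  then show ?case
    \<comment> \<open>The side condition says exactly that 0 is not in
      \<open>FCV (Throw \<beta> v)\<close>, so the whole \<open>Throw\<close> is
      strengthened.\<close>
    by (auto elim!: has_type_CatchE intro: has_type_drop_catch)
next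
  case (catch_value v)
  then show ?case
    by (auto elim!: has_type_CatchE intro: has_type_drop_catch)
next
  case (lrec_nil v\<^sub>r v\<^sub>s)
  then show ?case
    by (auto elim!: has_type_AppE has_type_LrecE)
next
  case (lrec_cons v\<^sub>r v\<^sub>s v\<^sub>h v\<^sub>t)
  \<comment> \<open>The element types found by inverting \<open>Lrec\<close> and
    \<open>ConsC\<close> coincide by injectivity of the type constructors.\<close>
  from lrec_cons.prems obtain \<sigma> where
    "has_type \<Gamma> \<Delta> v\<^sub>r \<rho>" "has_type \<Gamma> \<Delta> v\<^sub>s (\<sigma> \<rightarrow>\<^sub>t TList \<sigma> \<rightarrow>\<^sub>t \<rho> \<rightarrow>\<^sub>t \<rho>)"
    "has_type \<Gamma> \<Delta> v\<^sub>h \<sigma>" "has_type \<Gamma> \<Delta> v\<^sub>t (TList \<sigma>)"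
    by (auto elim!: has_type_AppE has_type_LrecE has_type_ConsCE)
  then show ?case
    by (meson has_type.App has_type.Lrec)
qed

lemma has_type_red:
  assumes "t \<leadsto> t'" and "has_type \<Gamma> \<Delta> t \<rho>"
  shows "has_type \<Gamma> \<Delta> t' \<rho>"
  using assms
\<comment> \<open>Both environments and the type vary, since reduction under a binder extends an
  environment and a subterm has its own type.\<close>
proof (induction arbitrary: \<Gamma> \<Delta> \<rho> rule: red.induct)
  case (contract t t')
  then show ?case by (rule has_type_contract)
next
  case (Lam t t')
  then show ?case by (auto elim!: has_type_LamE intro: has_type.Lam)
next
  case (AppL t t' s)
  then show ?case by (auto elim!: has_type_AppE intro: has_type.App)
next
  case (AppR s s' t)
  then show ?case by (auto elim!: has_type_AppE intro: has_type.App)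
next
  case (Catch t t')
  then show ?case by (auto elim!: has_type_CatchE intro: has_type.Catch)
next
  case (Throw t t' \<alpha>)
  then show ?case by (auto elim!: has_type_ThrowE intro: has_type.Throw)
qed

theorem theorem2p13:
  fixes \<Gamma> \<Delta> :: "nat \<rightharpoonup> ty" and t t' :: tm and \<rho> :: ty
  assumes "finite (dom \<Gamma>)"
    and "finite (dom \<Delta>)"
    and "\<forall>\<psi> \<in> ran \<Delta>. arrow_free \<psi>"
    and "has_type \<Gamma> \<Delta> t \<rho>"
    and "t \<leadsto> t'"
  shows "has_type \<Gamma> \<Delta> t' \<rho>"
  using assms(5,4) by (rule has_type_red)

end
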